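(* Let $\mathbf{z}=(z_n)$ be a sequence in $\mathbb{D}$ that is regular with respect to $\mathfrak{u}\in\beta\mathbb{N}\setminus\mathbb{N}$. Then, for each $\mathbf{k}\in \mathtt{Comp}_{\mathfrak{u}}(\mathbf{z})$, all the seminorms $\zeta_{\mathbf{z},\mathfrak{u}}^{\mathbf{k},r}$ with $r\in(0,1]$ have the same kernel.
   Context: $\mathbb{K}$ is an algebraically closed field, complete with respect to a nontrivial nonarchimedean absolute value $|\cdot|$; $\mathbb{D} = \{z \in \mathbb{K} : |z|<1\}$; $\mathbb{N}=\{1,2,\dots\}$; $\beta\mathbb{N}\setminus\mathbb{N}$ is the set of nonprincipal ultrafilters in $\mathbb{N}$. $H^\infty$ is the Banach $\mathbb{K}$-algebra of bounded power series $f(z)=\sum_{n\ge 0} a_n z^n$ on $\mathbb{D}$, with norm $\|f\| = \sup_n |a_n| = \sup_{z\in\mathbb{D}}|f(z)|$. For a seminorm $\varphi$ on $H^\infty$, $\ker\varphi = \{f\in H^\infty : \varphi(f)=0\}$. $D^+(z,r)$ is the closed disk with center $z$ and radius $r$, and for a disk $D\subset\mathbb{D}$, $\zeta_D(f) := \sup_{z\in D}|f(z)|$ for $f\in H^\infty$ (a multiplicative seminorm bounded by $\|\cdot\|$). A sequence $\mathbf{z}=(z_n)$ in $\mathbb{D}$ is regular with respect to $\mathfrak{u}$ if there is $C\in\mathfrak{u}$ with $\inf_{n\in C}\prod_{m\in C, m\ne n}|z_n-z_m|>0$. $\mathtt{Comp}_{\mathfrak{u}}(\mathbf{z})$ is the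 set of all sequences $\mathbf{k}=(k_n)$ in $\mathbb{N}$ for which there is $C\in\mathfrak{u}$ with $\inf_{n\in C}\prod_{m\in C, m\ne n}|z_n-z_m|^{k_m}>0$. For $\mathbf{k}\in\mathtt{Comp}_{\mathfrak{u}}(\mathbf{z})$ and $r\in(0,1)$, $\zeta_{\mathbf{z},\mathfrak{u}}^{\mathbf{k},r} := \lim_{\mathfrak{u}}\zeta_{D^+(z_n,\sqrt[k_n]{r})}$ (pointwise limit along $\mathfrak{u}$), and $\zeta_{\mathbf{z},\mathfrak{u}}^{\mathbf{k},1} := \lim_{r\to 1^-}\zeta_{\mathbf{z},\mathfrak{u}}^{\mathbf{k},r}$ (pointwise limit, which exists by monotonicity in $r$). *)

theory Defs
  imports "HOL-Analysis.Analysis" "HOL-Computational_Algebra.Formal_Power_Series"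
begin

text \<open>
  Fields with a nontrivial nonarchimedean absolute value, written \<open>absv\<close> because the library
  restricts \<open>norm\<close> to real normed spaces. The metric and the topology are the induced ones;
  nonnegativity and definiteness of the absolute value come from the metric axioms and
  \<open>dist_absv\<close>.
\<close>
class nonarch_field = field + metric_space +
  fixes absv :: "'a \<Rightarrow> real"
  assumes dist_absv: "dist x y = absv (x - y)"
    and absv_mult: "absv (x * y) = absv x * absv y"
    and absv_add: "absv (x + y) \<le> max (absv x) (absv y)"
    and absv_nontrivial: "\<exists>x. x \<noteq> 0 \<and> absv x \<noteq> 1"

lemma absv_ge_0: "absv (x::'k::nonarch_field) \<ge> 0"
  by (metis diff_zero dist_absv zero_le_dist)

lemma absv_minus: "absv (- x) = absv (x::'k::nonarch_field)"
  by (metis diff_0 diff_zero dist_commute dist_absv)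

lemma dist_0_absv: "dist 0 x = absv (x::'k::nonarch_field)"
  by (metis diff_zero dist_commute dist_absv)

abbreviation unit_disk :: "'k::nonarch_field set" where
  "unit_disk \<equiv> ball 0 1"

definition fps_val :: "'k::nonarch_field fps \<Rightarrow> 'k \<Rightarrow> 'k" where
  "fps_val f z = (\<Sum>n. fps_nth f n * z ^ n)"

text \<open>For the fields considered here (algebraically closed and complete) these are exactly the
  power series with bounded coefficients, and the supremum of the function equals that of the coefficients.\<close>
definition Hinf :: "'k::nonarch_field fps set" where
  "Hinf = {f. (\<forall>z\<in>unit_disk. summable (\<lambda>n. fps_nth f n * z ^ n)) \<and>
              bounded (fps_val f ` unit_disk)}"

text \<open>Seminorms on \<^term>\<open>Hinf\<close> are functions on all formal power series; only their values
  on \<^term>\<open>Hinf\<close> matter.\<close>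
definition seminorm_ker :: "('k::nonarch_field fps \<Rightarrow> real) \<Rightarrow> 'k fps set" where
  "seminorm_ker \<phi> = {f \<in> Hinf. \<phi> f = 0}"

definition zeta_disk :: "'k::nonarch_field set \<Rightarrow> 'k fps \<Rightarrow> real" where
  "zeta_disk D f = (SUP z\<in>D. absv (fps_val f z))"

text \<open>An ultrafilter \<open>\<uu>\<close> is a library filter; membership of a set \<open>C\<close> in \<open>\<uu>\<close> is
  \<^prop>\<open>eventually (\<lambda>n. n \<in> C) \<uu>\<close>.\<close>
definition is_ultrafilter :: "'a filter \<Rightarrow> bool" where
  "is_ultrafilter \<uu> \<longleftrightarrow> \<uu> \<noteq> bot \<and> (\<forall>C. eventually (\<lambda>n. n \<in> C) \<uu> \<or> eventually (\<lambda>n. n \<notin> C) \<uu>)"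

definition nonprincipal_ultrafilter :: "'a filter \<Rightarrow> bool" where
  "nonprincipal_ultrafilter \<uu> \<longleftrightarrow> is_ultrafilter \<uu> \<and> (\<forall>n. \<uu> \<noteq> principal {n})"

text \<open>The product of \<open>|z\<^sub>n - z\<^sub>m|^(k\<^sub>m)\<close> over \<open>m \<in> C\<close>, \<open>m \<noteq> n\<close>, is the limit of its
  partial products. The library's \<open>prodinf\<close> is not used because it is unspecified for
  products that diverge to zero, whereas here such a product has the value zero.\<close>
definition separation_prod ::
    "(nat \<Rightarrow> 'k::nonarch_field) \<Rightarrow> (nat \<Rightarrow> nat) \<Rightarrow> nat set \<Rightarrow> nat \<Rightarrow> real" where
  "separation_prod z k C n = lim (\<lambda>N. \<Prod>m\<in>{m\<in>C. m < N \<and> m \<noteq> n}. absv (z n - z m) ^ k m)"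

definition regular_seq :: "nat filter \<Rightarrow> (nat \<Rightarrow> 'k::nonarch_field) \<Rightarrow> bool" where
  "regular_seq \<uu> z \<longleftrightarrow>
     (\<exists>C. eventually (\<lambda>n. n \<in> C) \<uu> \<and> (INF n\<in>C. separation_prod z (\<lambda>_. 1) C n) > 0)"

definition Comp :: "nat filter \<Rightarrow> (nat \<Rightarrow> 'k::nonarch_field) \<Rightarrow> (nat \<Rightarrow> nat) set" where
  "Comp \<uu> z = {k. (\<forall>n. k n \<ge> 1) \<and>
     (\<exists>C. eventually (\<lambda>n. n \<in> C) \<uu> \<and> (INF n\<in>C. separation_prod z k C n) > 0)}"

definition zeta_lt1 ::
    "nat filter \<Rightarrow> (nat \<Rightarrow> 'k::nonarch_field) \<Rightarrow> (nat \<Rightarrow> nat) \<Rightarrow> real \<Rightarrow> 'k fps \<Rightarrow> real" where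
  "zeta_lt1 \<uu> z k r f = Lim \<uu> (\<lambda>n. zeta_disk (cball (z n) (root (k n) r)) f)"

definition zeta ::
    "nat filter \<Rightarrow> (nat \<Rightarrow> 'k::nonarch_field) \<Rightarrow> (nat \<Rightarrow> nat) \<Rightarrow> real \<Rightarrow> 'k fps \<Rightarrow> real" where
  "zeta \<uu> z k r f =
     (if r = 1 then Lim (at_left 1) (\<lambda>s. zeta_lt1 \<uu> z k s f) else zeta_lt1 \<uu> z k r f)"

text \<open>The limits in the definitions above exist in the cases of interest, so that \<^const>\<open>lim\<close> and
  \<^const>\<open>Lim\<close> denote actual limits.\<close>

lemma separation_prod_LIMSEQ:
  fixes z :: "nat \<Rightarrow> 'k::nonarch_field"
  assumes "range z \<subseteq> unit_disk"
  shows "(\<lambda>N. \<Prod>m\<in>{m\<in>C. m < N \<and> m \<noteq> n}. absv (z n - z m) ^ k m)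
           \<longlonglongrightarrow> separation_prod z k C n"
proof -
  note nn = absv_ge_0 and neg = absv_minus and d0 = dist_0_absv
  have lt: "absv (z i) < 1" for i
    using subsetD[OF assms rangeI[of z i]] by (simp add: d0)
  have le: "absv (z i - z j) \<le> 1" for i j
    using absv_add[of "z i" "- z j"] lt[of i] lt[of j] by (simp add: neg max_def split: if_splits)
  let ?X = "\<lambda>N. \<Prod>m\<in>{m\<in>C. m < N \<and> m \<noteq> n}. absv (z n - z m) ^ k m"
  have "decseq ?X"
    unfolding decseq_def
  proof (intro allI impI)
    fix M N :: nat assume "M \<le> N"
    have fin: "finite {m\<in>C. m < N \<and> m \<noteq> n}" by simp
    have sub: "{m\<in>C. m < M \<and> m \<noteq> n} \<subseteq> {m\<in>C. m < N \<and> m \<noteq> n}" using \<open>M \<le> N\<close> by auto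
    have "?X N = (\<Prod>m\<in>{m\<in>C. m < N \<and> m \<noteq> n} - {m\<in>C. m < M \<and> m \<noteq> n}. absv (z n - z m) ^ k m) * ?X M"
      using prod.subset_diff[OF sub fin] by simp
    also have "\<dots> \<le> 1 * ?X M"
      by (intro mult_right_mono prod_le_1 prod_nonneg) (auto simp: nn le intro: power_le_one)
    finally show "?X N \<le> ?X M" by simp
  qed
  moreover have "0 \<le> ?X N" for N by (intro prod_nonneg) (auto simp: nn)
  ultimately have "convergent ?X"
    using decseq_convergent[of ?X 0] convergentI by blast
  then show ?thesis
    unfolding separation_prod_def by (simp add: convergent_LIMSEQ_iff)
qed

lemma ultrafilter_bounded_tendsto_Lim:
  fixes g :: "'a \<Rightarrow> real"
  assumes "is_ultrafilter \<uu>" "\<And>n. g n \<in> {a..b}"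
  shows "(g \<longlongrightarrow> Lim \<uu> g) \<uu>" "Lim \<uu> g \<in> {a..b}"
proof -
  have nb: "\<uu> \<noteq> bot" using assms(1) by (simp add: is_ultrafilter_def)
  have nb': "filtermap g \<uu> \<noteq> bot" using nb by (simp add: filtermap_bot_iff)
  have "eventually (\<lambda>x. x \<in> {a..b}) (filtermap g \<uu>)"
    using assms(2) by (simp add: eventually_filtermap)
  then obtain l where l: "l \<in> {a..b}" "inf (nhds l) (filtermap g \<uu>) \<noteq> bot"
    using compact_Icc[of a b, unfolded compact_filter, rule_format, OF nb'] by blast
  have "(g \<longlongrightarrow> l) \<uu>"
  proof (rule topological_tendstoI)
    fix S assume S: "open S" "l \<in> S"
    show "eventually (\<lambda>n. g n \<in> S) \<uu>"
    proof (rule ccontr)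
      assume no: "\<not> ?thesis"
      have "\<forall>C. eventually (\<lambda>n. n \<in> C) \<uu> \<or> eventually (\<lambda>n. n \<notin> C) \<uu>"
        using assms(1) by (simp add: is_ultrafilter_def)
      from spec[OF this, of "{n. g n \<in> S}"] have "eventually (\<lambda>n. g n \<notin> S) \<uu>"
        using no by simp
      then have "eventually (\<lambda>x. x \<notin> S) (filtermap g \<uu>)" by (simp add: eventually_filtermap)
      moreover have "eventually (\<lambda>x. x \<in> S) (nhds l)" using S by (rule eventually_nhds_in_open)
      ultimately have "eventually (\<lambda>x. False) (inf (nhds l) (filtermap g \<uu>))"
        unfolding eventually_inf by (intro exI[of _ "\<lambda>x. x \<in> S"] exI[of _ "\<lambda>x. x \<notin> S"]) auto
      then show False using l by (simp add: trivial_limit_def)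
    qed
  qed
  moreover have "Lim \<uu> g = l" using calculation nb by (intro tendsto_Lim) auto
  ultimately show "(g \<longlongrightarrow> Lim \<uu> g) \<uu>" "Lim \<uu> g \<in> {a..b}" using l by auto
qed

lemma zeta_limits:
  fixes z :: "nat \<Rightarrow> 'k::nonarch_field"
  assumes u: "is_ultrafilter \<uu>" and z: "range z \<subseteq> unit_disk" and k: "\<And>n. k n \<ge> 1" and f: "f \<in> Hinf"
  shows "\<And>r. 0 < r \<Longrightarrow> r < 1 \<Longrightarrow>
           ((\<lambda>n. zeta_disk (cball (z n) (root (k n) r)) f) \<longlongrightarrow> zeta \<uu> z k r f) \<uu>"
    and "((\<lambda>r. zeta \<uu> z k r f) \<longlongrightarrow> zeta \<uu> z k 1 f) (at_left 1)"
proof -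
  note nn = absv_ge_0 and neg = absv_minus and d0 = dist_0_absv
  obtain B where B: "\<And>w. w \<in> unit_disk \<Longrightarrow> absv (fps_val f w) \<le> B"
    using f unfolding Hinf_def bounded_any_center[where a=0] by (auto simp: d0 simp del: mem_ball)
  let ?D = "\<lambda>r n. cball (z n) (root (k n) r)"
  have sub: "?D r n \<subseteq> unit_disk" if "0 < r" "r < 1" for r n
  proof
    fix w assume "w \<in> ?D r n"
    then have "absv (z n - w) \<le> root (k n) r" by (simp add: dist_absv)
    moreover have "root (k n) r < 1" using that k[of n] by (simp add: Suc_le_eq)
    ultimately have 1: "absv (w - z n) < 1" using neg[of "z n - w"] by simp
    have 2: "absv (z n) < 1" using subsetD[OF z rangeI[of z n]] by (simp add: d0)
    show "w \<in> unit_disk" using absv_add[of "w - z n" "z n"] 1 2 by (auto simp: d0)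
  qed
  have mem: "z n \<in> ?D r n" if "0 < r" for r n using that k[of n] by (simp add: Suc_le_eq)
  have bdd: "bdd_above ((\<lambda>w. absv (fps_val f w)) ` ?D r n)" if "0 < r" "r < 1" for r n
    using B subsetD[OF sub[OF that]] by (intro bdd_aboveI[of _ B]) blast
  have rng: "zeta_disk (?D r n) f \<in> {0..B}" if "0 < r" "r < 1" for r n
  proof -
    have "absv (fps_val f (z n)) \<le> zeta_disk (?D r n) f"
      unfolding zeta_disk_def using mem[OF that(1)] bdd[OF that] by (intro cSUP_upper) auto
    moreover have "zeta_disk (?D r n) f \<le> B"
      unfolding zeta_disk_def using mem[OF that(1)] B sub[OF that] by (intro cSUP_least) blast+
    ultimately show ?thesis using nn order_trans by auto
  qed
  note L = ultrafilter_bounded_tendsto_Lim[OF u, of "\<lambda>n. zeta_disk (?D r n) f" 0 B for r]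
  show lim: "((\<lambda>n. zeta_disk (?D r n) f) \<longlongrightarrow> zeta \<uu> z k r f) \<uu>" if "0 < r" "r < 1" for r
    using L(1)[of r] rng[OF that] that by (simp add: zeta_def zeta_lt1_def)
  have zr: "zeta \<uu> z k r f \<in> {0..B}" if "0 < r" "r < 1" for r
    using L(2)[of r] rng[OF that] that by (simp add: zeta_def zeta_lt1_def)
  have mono: "zeta \<uu> z k r f \<le> zeta \<uu> z k s f" if "0 < r" "r \<le> s" "s < 1" for r s
  proof (rule tendsto_le[OF _ lim lim])
    show "\<uu> \<noteq> bot" using u by (simp add: is_ultrafilter_def)
    have "zeta_disk (?D r n) f \<le> zeta_disk (?D s n) f" for n
      unfolding zeta_disk_def
    proof (rule cSUP_subset_mono)
      show "?D r n \<noteq> {}" using mem that by blast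
      show "bdd_above ((\<lambda>w. absv (fps_val f w)) ` ?D s n)" using bdd that by simp
      have "root (k n) r \<le> root (k n) s" using k[of n] that by (simp add: Suc_le_eq)
      then show "?D r n \<subseteq> ?D s n" by auto
    qed auto
    then show "eventually (\<lambda>n. zeta_disk (?D r n) f \<le> zeta_disk (?D s n) f) \<uu>" by simp
  qed (use that in auto)
  let ?l = "SUP r\<in>{0<..<1}. zeta \<uu> z k r f"
  have bd: "bdd_above ((\<lambda>r. zeta \<uu> z k r f) ` {0<..<1})"
    using zr by (intro bdd_aboveI[of _ B]) auto
  have T: "((\<lambda>r. zeta \<uu> z k r f) \<longlongrightarrow> ?l) (at_left 1)"
  proof (rule order_tendstoI)
    fix a assume "a < ?l"
    then obtain r where r: "0 < r" "r < 1" "a < zeta \<uu> z k r f"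
      using less_cSUP_iff[OF _ bd] by auto
    have "eventually (\<lambda>s. s \<in> {r<..<1}) (at_left 1)"
      using r by (intro eventually_at_left_real)
    then show "eventually (\<lambda>s. a < zeta \<uu> z k s f) (at_left 1)"
      by eventually_elim (use r mono in \<open>force intro: less_le_trans\<close>)
  next
    fix a assume a: "?l < a"
    have "eventually (\<lambda>s. s \<in> {0<..<1}) (at_left (1::real))"
      by (intro eventually_at_left_real) auto
    then show "eventually (\<lambda>s. zeta \<uu> z k s f < a) (at_left 1)"
    proof eventually_elim
      case (elim s)
      then have "zeta \<uu> z k s f \<le> ?l" by (intro cSUP_upper bd)
      then show ?case using a by simp
    qed
  qed
  have ev: "eventually (\<lambda>s. zeta_lt1 \<uu> z k s f = zeta \<uu> z k s f) (at_left 1)"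
    by (auto simp: zeta_def eventually_at_filter)
  have "((\<lambda>r. zeta_lt1 \<uu> z k r f) \<longlongrightarrow> ?l) (at_left 1)"
    using T tendsto_cong[OF ev] by simp
  then have "Lim (at_left 1) (\<lambda>r. zeta_lt1 \<uu> z k r f) = ?l"
    by (intro tendsto_Lim) auto
  then have "zeta \<uu> z k 1 f = ?l" by (simp add: zeta_def)
  then show "((\<lambda>r. zeta \<uu> z k r f) \<longlongrightarrow> zeta \<uu> z k 1 f) (at_left 1)"
    using T by simp
qed

end

theory Submission
  imports Defs
begin

text \<open>
  The proof rests on a nonarchimedean form of Hadamard's three circles theorem. Let \<open>f\<close> be bounded
  by \<open>B\<close> on the unit disk and let \<open>M(\<rho>)\<close> be the supremum of \<open>|f|\<close> on the disk of radius \<open>\<rho>\<close> about a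
  point \<open>c\<close>. If \<open>f(c + w) = \<Sum> b\<^sub>j w^j\<close>, then \<open>M(\<rho>)\<close> is the supremum of the numbers \<open>|b\<^sub>j| \<rho>^j\<close>, and
  therefore \<open>log M\<close> is a convex function of \<open>log \<rho>\<close>. What is used is the multiplicative form of
  convexity, for radii in \<open>(0,1)\<close>: \<open>\<sigma>^(m+1) \<le> \<rho> \<tau>^m\<close> implies \<open>M(\<sigma>)^(m+1) \<le> M(\<rho>) B^m\<close>
  (\<open>zeta_disk_three_circles\<close>).

  The hypothesis on the radii is stable under taking \<open>k\<^sub>n\<close>-th roots, so the inequality for the
  disks about \<open>z\<^sub>n\<close> with radii the \<open>k\<^sub>n\<close>-th roots of \<open>s\<close> and \<open>r\<close> has the same exponent \<open>m\<close>
  for every \<open>n\<close>, and it passes to the limit along the ultrafilter (\<open>zeta_three_circles\<close>). Given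
  \<open>r\<close> and \<open>s\<close> in \<open>(0,1)\<close>, a suitable \<open>m\<close> always exists; hence vanishing of the seminorm with parameter
  \<open>r\<close> forces vanishing of the one with parameter \<open>s\<close>. The parameter \<open>1\<close> is then covered by the
  limit \<open>s \<rightarrow> 1\<close> in one direction and by monotonicity in the other (\<open>zeta_eq_0_iff\<close>).

  The one delicate point of the three circles inequality is Cauchy's estimate \<open>|b\<^sub>j| \<rho>^j \<le> M(\<rho>)\<close>
  (\<open>poly_coeff_bound\<close>). It holds because the value group of an algebraically closed field with a
  nontrivial absolute value is dense, so that there are points with \<open>|w|\<close> close to \<open>\<rho>\<close> at which
  no two nonzero terms have the same absolute value. The argument is carried out for polynomials, where
  a change of the centre is a composition, and transferred to \<open>f\<close> by uniform approximation on
  smaller disks.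
\<close>

section \<open>Ultrametric estimates for finite sums\<close>

lemma absv_0 [simp]: "absv (0::'k::nonarch_field) = 0"
  using dist_absv[of "0::'k" 0] by simp

lemma absv_eq_0_iff [simp]: "absv x = 0 \<longleftrightarrow> x = (0::'k::nonarch_field)"
  by (metis dist_0_absv dist_eq_0_iff)

lemma absv_1 [simp]: "absv (1::'k::nonarch_field) = 1"
  using absv_mult[of "1::'k" 1] absv_eq_0_iff[of "1::'k"] by simp

lemma absv_power: "absv (x ^ n) = absv (x::'k::nonarch_field) ^ n"
  by (induction n) (simp_all add: absv_mult)

lemma absv_minus_commute: "absv (x - y) = absv (y - x :: 'k::nonarch_field)"
  by (metis absv_minus minus_diff_eq)

lemma absv_le_max_diff: "absv x \<le> max (absv y) (absv (x - y :: 'k::nonarch_field))"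
  using absv_add[of y "x - y"] by simp

lemma absv_sum_le:
  fixes g :: "'a \<Rightarrow> 'k::nonarch_field"
  assumes "\<And>i. i \<in> S \<Longrightarrow> absv (g i) \<le> C" "0 \<le> C"
  shows "absv (sum g S) \<le> C"
  using assms(1)
proof (induction S rule: infinite_finite_induct)
  case (insert x F)
  have "absv (g x + sum g F) \<le> max (absv (g x)) (absv (sum g F))" by (rule absv_add)
  also have "\<dots> \<le> C" using insert by simp
  finally show ?case using insert by simp
qed (use assms(2) in auto)

text \<open>
  The strict form of the ultrametric inequality: no cancellation is possible at the largest term
  when the nonzero terms have distinct absolute values.
\<close>
lemma absv_le_absv_sum:
  fixes g :: "'a \<Rightarrow> 'k::nonarch_field"
  assumes S: "finite S" "i \<in> S"
    and distinct: "\<And>i j. i \<in> S \<Longrightarrow> j \<in> S \<Longrightarrow> i \<noteq> j \<Longrightarrow> g i \<noteq> 0 \<Longrightarrow> absv (g i) \<noteq> absv (g j)"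
  shows "absv (g i) \<le> absv (sum g S)"
proof -
  have "Max ((\<lambda>j. absv (g j)) ` S) \<in> (\<lambda>j. absv (g j)) ` S" using S by (intro Max_in) auto
  then obtain l where l: "l \<in> S" "absv (g l) = Max ((\<lambda>j. absv (g j)) ` S)" by auto
  have le: "absv (g j) \<le> absv (g l)" if "j \<in> S" for j
    using that S(1) by (simp add: l(2))
  have "absv (g l) \<le> absv (sum g S)"
  proof (rule ccontr)
    assume neg: "\<not> ?thesis"
    then have nz: "g l \<noteq> 0" using absv_ge_0 by fastforce
    have "absv (g l) = absv (sum g S - sum g (S - {l}))"
      using sum.remove[OF S(1) l(1), of g] by simp
    also have "\<dots> \<le> max (absv (sum g S)) (absv (sum g (S - {l})))"
      using absv_add[of "sum g S" "- sum g (S - {l})"] by (simp add: absv_minus)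
    finally have *: "absv (g l) \<le> absv (sum g (S - {l}))" using neg by simp
    define C where "C = Max (insert 0 ((\<lambda>j. absv (g j)) ` (S - {l})))"
    have "absv (sum g (S - {l})) \<le> C"
      using S(1) by (intro absv_sum_le) (auto simp: C_def)
    moreover have "C < absv (g l)"
    proof -
      have "absv (g j) < absv (g l)" if "j \<in> S - {l}" for j
        using distinct[OF l(1), of j] le[of j] nz that by (auto simp: less_le)
      moreover have "0 < absv (g l)"
        using nz absv_ge_0[of "g l"] absv_eq_0_iff[of "g l"] by linarith
      ultimately show ?thesis using S(1) by (simp add: C_def)
    qed
    ultimately show False using * by simp
  qed
  with le[OF S(2)] show ?thesis by simp
qed

section \<open>Density of the value group\<close>

text \<open>
  Roots of an element of absolute value less than one give absolute values arbitrarily close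
  to one; the powers of such a root are a geometric progression that cannot jump over the interval.
\<close>
lemma exists_absv_between:
  assumes "0 \<le> a" "a < b" "b \<le> 1"
  shows "\<exists>w::'k::{nonarch_field, alg_closed_field}. a < absv w \<and> absv w < b"
proof -
  obtain x0 :: 'k where x0: "x0 \<noteq> 0" "absv x0 \<noteq> 1" using absv_nontrivial by blast
  have "absv x0 * absv (inverse x0) = 1" using x0 absv_mult[of x0 "inverse x0"] by simp
  then have "absv x0 < 1 \<or> absv (inverse x0) < 1"
    using x0(2) less_1_mult[of "absv x0" "absv (inverse x0)"]
    by (metis linorder_neqE_linordered_idom mult.right_neutral order_less_irrefl)
  then obtain x :: 'k where x: "x \<noteq> 0" "absv x < 1" using x0 by (metis inverse_nonzero_iff_nonzero)
  have x_pos: "0 < absv x" using x absv_ge_0[of x] absv_eq_0_iff[of x] by linarith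
  have "(\<lambda>n. root n (absv x)) \<longlonglongrightarrow> 1" using x_pos by (rule LIMSEQ_root_const)
  moreover have "a / b < 1" using assms by (simp add: divide_simps)
  ultimately have "eventually (\<lambda>n. a / b < root n (absv x) \<and> n > 0) sequentially"
    using order_tendstoD(1) eventually_gt_at_top eventually_conj by blast
  then obtain n where n: "a / b < root n (absv x)" "n > 0"
    by (metis (mono_tags, lifting) eventually_sequentially order_refl)
  obtain y where y: "y ^ n = x" using nth_root_exists[OF n(2)] by blast
  define c where "c = absv y"
  have "c ^ n = absv x" using y absv_power[of y n] by (simp add: c_def)
  then have c: "c = root n (absv x)"
    using n real_root_power_cancel[of n c] absv_ge_0[of y] by (simp add: c_def)
  then have c01: "c < 1" "0 < c" using n x x_pos by simp_all
  obtain m where "c ^ m < b" using real_arch_pow_inv[of b c] assms c01 by auto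
  define m where "m = (LEAST m. c ^ m < b)"
  have m: "c ^ m < b" unfolding m_def using \<open>c ^ _ < b\<close> by (rule LeastI)
  then have "m \<noteq> 0" using assms by (intro notI) simp
  then have "b \<le> c ^ (m - 1)" using not_less_Least[of "m - 1" "\<lambda>m. c ^ m < b"] by (simp add: m_def)
  then have "c * b \<le> c ^ m" using c01 \<open>m \<noteq> 0\<close> by (simp add: power_eq_if)
  moreover have "a < c * b" using n assms c by (simp add: divide_simps)
  ultimately show ?thesis using m by (intro exI[of _ "y ^ m"]) (simp add: absv_power c_def)
qed

lemma exists_absv_between_avoiding:
  assumes "0 \<le> a" "a < b" "b \<le> 1" and "finite E"
  shows "\<exists>w::'k::{nonarch_field, alg_closed_field}. a < absv w \<and> absv w < b \<and> absv w \<notin> E"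
proof -
  \<comment> \<open>No point of \<open>E\<close> lies strictly between \<open>a'\<close> and \<open>b\<close>.\<close>
  define a' where "a' = Max (insert a {e\<in>E. e < b})"
  have "a \<le> a'" "a' < b" using assms by (auto simp: a'_def)
  then obtain w :: 'k where w: "a' < absv w" "absv w < b"
    using exists_absv_between[of a' b] assms by auto
  have "e \<le> a'" if "e \<in> E" "e < b" for e
    unfolding a'_def using that assms by (intro Max_ge) auto
  then show ?thesis using w \<open>a \<le> a'\<close> by (intro exI[of _ w]) force
qed

section \<open>The three circles inequality\<close>

text \<open>
  Cauchy's estimate. Two nonzero terms of the polynomial have equal absolute values for at most
  one value of \<open>|w|\<close>, so for \<open>|w|\<close> just below \<open>\<rho>\<close>, outside a finite set, no cancellation occurs and
  every term is dominated by the value of the polynomial.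
\<close>
lemma poly_coeff_bound:
  fixes p :: "'k::{nonarch_field, alg_closed_field} poly"
  assumes \<rho>: "0 < \<rho>" "\<rho> \<le> 1" and bound: "\<And>w. absv w \<le> \<rho> \<Longrightarrow> absv (poly p w) \<le> A"
  shows "absv (coeff p j) * \<rho> ^ j \<le> A"
proof (cases "j \<le> degree p")
  case False
  then show ?thesis using bound[of 0] \<rho> absv_ge_0[of "poly p 0"] by (simp add: coeff_eq_0)
next
  case j: True
  define S where "S = {..degree p}"
  \<comment> \<open>For \<open>i < l\<close> the exceptional radius solves \<open>|p\<^sub>i| t^i = |p\<^sub>l| t^l\<close>.\<close>
  define E where "E = (\<lambda>(i, l). root (l - i) (absv (coeff p i) / absv (coeff p l))) ` (S \<times> S)"
  have E: "finite E" by (simp add: E_def S_def)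
  have exceptional: "absv w \<in> E"
    if "i \<in> S" "l \<in> S" "i < l" "coeff p l \<noteq> 0" "w \<noteq> 0"
      "absv (coeff p i * w ^ i) = absv (coeff p l * w ^ l)" for i l w
  proof -
    have "absv w ^ l = absv w ^ (l - i) * absv w ^ i"
      using that(3) by (simp flip: power_add)
    then have "absv (coeff p i) = absv (coeff p l) * absv w ^ (l - i)"
      using that by (simp add: absv_mult absv_power)
    then have "absv w ^ (l - i) = absv (coeff p i) / absv (coeff p l)"
      using that by simp
    then have "absv w = root (l - i) (absv (coeff p i) / absv (coeff p l))"
      using that(3) absv_ge_0[of w] by (metis real_root_power_cancel zero_less_diff)
    then show ?thesis using that unfolding E_def by force
  qed
  have below: "absv (coeff p j) * a ^ j \<le> A" if a: "0 < a" "a < \<rho>" for a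
  proof -
    obtain w :: 'k where w: "a < absv w" "absv w < \<rho>" "absv w \<notin> E"
      using exists_absv_between_avoiding[of a \<rho> E] a \<rho> E by auto
    have w0: "w \<noteq> 0" using w a by auto
    have "absv (coeff p j * w ^ j) \<le> absv (\<Sum>i\<in>S. coeff p i * w ^ i)"
    proof (rule absv_le_absv_sum)
      fix i l assume il: "i \<in> S" "l \<in> S" "i \<noteq> l" and nz: "coeff p i * w ^ i \<noteq> 0"
      show "absv (coeff p i * w ^ i) \<noteq> absv (coeff p l * w ^ l)"
      proof
        assume eq: "absv (coeff p i * w ^ i) = absv (coeff p l * w ^ l)"
        then have "coeff p l \<noteq> 0" using nz by (metis absv_eq_0_iff mult_zero_left)
        moreover have "coeff p i \<noteq> 0" using nz by simp
        ultimately show False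
          using exceptional[OF il(1,2)] exceptional[OF il(2,1)] il(3) w0 eq w(3)
          by (metis linorder_neqE_nat)
      qed
    qed (use j in \<open>auto simp: S_def\<close>)
    also have "\<dots> \<le> A" using bound[of w] w by (simp add: poly_altdef S_def)
    finally have "absv (coeff p j) * absv w ^ j \<le> A" by (simp add: absv_mult absv_power)
    moreover have "absv (coeff p j) * a ^ j \<le> absv (coeff p j) * absv w ^ j"
      using a w absv_ge_0 by (intro mult_left_mono power_mono) auto
    ultimately show ?thesis by simp
  qed
  have "((\<lambda>a. absv (coeff p j) * a ^ j) \<longlongrightarrow> absv (coeff p j) * \<rho> ^ j) (at_left \<rho>)"
    by (intro tendsto_intros)
  moreover have "eventually (\<lambda>a. absv (coeff p j) * a ^ j \<le> A) (at_left \<rho>)"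
    using eventually_at_left_real[OF \<rho>(1)] by eventually_elim (use below in auto)
  ultimately show ?thesis by (intro tendsto_upperbound) auto
qed

lemma le_root_if_power_le:
  fixes a y :: real
  assumes "0 \<le> a" "a ^ Suc m \<le> y"
  shows "a \<le> root (Suc m) y"
proof -
  have "a = root (Suc m) (a ^ Suc m)"
    using assms(1) by (intro real_root_power_cancel[symmetric]) simp_all
  also have "\<dots> \<le> root (Suc m) y" using assms(2) by (intro real_root_le_mono) simp_all
  finally show ?thesis .
qed

text \<open>
  After moving the centre to the origin, each term of the polynomial satisfies the inequality
  by the choice of the radii, and the ultrametric inequality passes it to the sum.
\<close>
lemma poly_three_circles:
  fixes p :: "'k::{nonarch_field, alg_closed_field} poly"
  assumes \<rho>: "0 < \<rho>" "\<rho> \<le> 1" and \<tau>: "0 < \<tau>" "\<tau> \<le> 1"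
    and \<sigma>: "\<sigma> ^ Suc m \<le> \<rho> * \<tau> ^ m"
    and A: "\<And>w. w \<in> cball c \<rho> \<Longrightarrow> absv (poly p w) \<le> A"
    and B: "\<And>w. w \<in> cball c \<tau> \<Longrightarrow> absv (poly p w) \<le> B"
    and w: "w \<in> cball c \<sigma>"
  shows "absv (poly p w) ^ Suc m \<le> A * B ^ m"
proof -
  define q where "q = p \<circ>\<^sub>p [:c, 1:]"
  define v where "v = w - c"
  have q: "poly q x = poly p (c + x)" for x by (simp add: q_def poly_pcompose add.commute)
  have shift: "c + x \<in> cball c R \<longleftrightarrow> absv x \<le> R" for x R by (simp add: dist_absv absv_minus)
  have v: "absv v \<le> \<sigma>" using w shift[of v \<sigma>] by (simp add: v_def)
  then have \<sigma>0: "0 \<le> \<sigma>" using absv_ge_0[of v] by linarith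
  have coeffA: "absv (coeff q j) * \<rho> ^ j \<le> A" for j
    by (rule poly_coeff_bound[OF \<rho>]) (simp add: q A[OF iffD2[OF shift]])
  have coeffB: "absv (coeff q j) * \<tau> ^ j \<le> B" for j
    by (rule poly_coeff_bound[OF \<tau>]) (simp add: q B[OF iffD2[OF shift]])
  have nonneg: "0 \<le> A" "0 \<le> B"
    using coeffA[of 0] coeffB[of 0] absv_ge_0[of "coeff q 0"] by auto
  have "absv (coeff q j * v ^ j) \<le> root (Suc m) (A * B ^ m)" for j
  proof -
    let ?b = "absv (coeff q j)"
    have b: "0 \<le> ?b" by (rule absv_ge_0)
    have "absv (coeff q j * v ^ j) ^ Suc m \<le> (?b * \<sigma> ^ j) ^ Suc m"
      unfolding absv_mult absv_power using v absv_ge_0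
      by (intro power_mono mult_left_mono mult_nonneg_nonneg) auto
    also have "\<dots> = ?b ^ Suc m * (\<sigma> ^ Suc m) ^ j"
      by (simp only: power_mult_distrib power_mult[symmetric] mult.commute[of j])
    also have "\<dots> \<le> ?b ^ Suc m * (\<rho> * \<tau> ^ m) ^ j"
      using \<sigma> \<sigma>0 b by (intro mult_left_mono power_mono) auto
    also have "\<dots> = (?b * \<rho> ^ j) * (?b * \<tau> ^ j) ^ m"
      by (simp add: power_mult_distrib mult_ac flip: power_mult)
    also have "\<dots> \<le> A * B ^ m"
      using coeffA coeffB nonneg b \<rho> \<tau> by (intro mult_mono power_mono) auto
    finally show ?thesis using absv_ge_0 by (intro le_root_if_power_le)
  qed
  then have "absv (poly q v) \<le> root (Suc m) (A * B ^ m)"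
    unfolding poly_altdef using nonneg by (intro absv_sum_le) auto
  then have "absv (poly q v) ^ Suc m \<le> root (Suc m) (A * B ^ m) ^ Suc m"
    using absv_ge_0 by (intro power_mono)
  also have "\<dots> = A * B ^ m" using nonneg by (intro real_root_pow_pos2) auto
  finally show ?thesis by (simp add: q v_def)
qed

text \<open>
  Partial sums converge uniformly on smaller disks: all the terms on the disk \<open>|w| \<le> R\<close> are
  dominated by those at a single point \<open>y\<close> with \<open>R < |y| < 1\<close>, which tend to zero, and the
  ultrametric inequality bounds a tail by its largest term.
\<close>
lemma fps_val_poly_approx:
  fixes f :: "'k::{nonarch_field, alg_closed_field} fps"
  assumes summable: "\<And>w. w \<in> unit_disk \<Longrightarrow> summable (\<lambda>n. fps_nth f n * w ^ n)"
    and R: "0 \<le> R" "R < 1" and e: "0 < e"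
  shows "\<exists>p. \<forall>w\<in>cball 0 R. absv (fps_val f w - poly p w) \<le> e"
proof -
  obtain y :: 'k where y: "R < absv y" "absv y < 1" using exists_absv_between[of R 1] R by auto
  let ?s = "\<lambda>w n. \<Sum>i<n. fps_nth f i * w ^ i"
  have sums: "?s w \<longlonglongrightarrow> fps_val f w" if "absv w < 1" for w
  proof -
    from summable[of w] that obtain l where l: "(\<lambda>n. fps_nth f n * w ^ n) sums l"
      by (auto simp: dist_0_absv summable_def)
    then have "fps_val f w = l" unfolding fps_val_def by (rule sums_unique[symmetric])
    with l show ?thesis by (simp add: sums_def)
  qed
  have "Cauchy (?s y)" using sums[OF y(2)] by (rule LIMSEQ_imp_Cauchy)
  then obtain N where N: "\<And>m n. m \<ge> N \<Longrightarrow> n \<ge> N \<Longrightarrow> dist (?s y m) (?s y n) < e"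
    using e unfolding Cauchy_def by blast
  have term_le: "absv (fps_nth f i * y ^ i) \<le> e" if "i \<ge> N" for i
    using N[of "Suc i" i] that by (simp add: dist_absv)
  define p where "p = (\<Sum>i<N. monom (fps_nth f i) i)"
  have p: "poly p w = ?s w N" for w by (simp add: p_def poly_sum poly_monom)
  have "absv (fps_val f w - poly p w) \<le> e" if w: "w \<in> cball 0 R" for w
  proof -
    have wy: "absv w \<le> absv y" using w y by (simp add: dist_0_absv)
    have "dist (?s w n) (?s w N) \<le> e" if n: "n \<ge> N" for n
    proof -
      have "?s w n - ?s w N = (\<Sum>i\<in>{N..<n}. fps_nth f i * w ^ i)"
        using n by (simp add: lessThan_atLeast0 sum_diff_nat_ivl)
      also have "absv \<dots> \<le> e"
      proof (rule absv_sum_le)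
        fix i assume "i \<in> {N..<n}"
        have "absv (fps_nth f i * w ^ i) \<le> absv (fps_nth f i * y ^ i)"
          unfolding absv_mult absv_power using wy absv_ge_0 by (intro mult_left_mono power_mono) auto
        also have "\<dots> \<le> e" using term_le \<open>i \<in> _\<close> by simp
        finally show "absv (fps_nth f i * w ^ i) \<le> e" .
      qed (use e in simp)
      finally show ?thesis by (simp add: dist_absv)
    qed
    moreover have "(\<lambda>n. dist (?s w n) (?s w N)) \<longlonglongrightarrow> dist (fps_val f w) (?s w N)"
      using sums[of w] wy y by (intro tendsto_dist) auto
    ultimately have "dist (fps_val f w) (?s w N) \<le> e"
      by (intro LIMSEQ_le_const2) auto
    then show ?thesis by (simp add: dist_absv p)
  qed
  then show ?thesis by blast
qed

text \<open>
  The bounds \<open>A\<close> and \<open>B\<close> are positive numbers rather than the suprema themselves, which may be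
  zero: the error of the polynomial approximation has to be at most \<open>A\<close> and at most \<open>B\<close>.
\<close>
lemma Hinf_three_circles_pointwise:
  fixes f :: "'k::{nonarch_field, alg_closed_field} fps"
  assumes f: "f \<in> Hinf" and c: "c \<in> unit_disk"
    and \<rho>: "0 < \<rho>" "\<rho> < 1" and \<tau>: "0 < \<tau>" "\<tau> < 1"
    and \<sigma>: "\<sigma> < 1" "\<sigma> ^ Suc m \<le> \<rho> * \<tau> ^ m"
    and A: "0 < A" "\<And>w. w \<in> cball c \<rho> \<Longrightarrow> absv (fps_val f w) \<le> A"
    and B: "0 < B" "\<And>w. w \<in> cball c \<tau> \<Longrightarrow> absv (fps_val f w) \<le> B"
    and w: "w \<in> cball c \<sigma>"
  shows "absv (fps_val f w) ^ Suc m \<le> A * B ^ m"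
proof (cases "fps_val f w = 0")
  case True
  then show ?thesis using A(1) B(1) by simp
next
  case False
  then have fw: "0 < absv (fps_val f w)"
    using absv_ge_0[of "fps_val f w"] absv_eq_0_iff[of "fps_val f w"] by linarith
  define R where "R = Max {absv c, \<rho>, \<sigma>, \<tau>}"
  have R: "0 \<le> R" "R < 1" using c \<rho> \<tau> \<sigma> by (auto simp: R_def dist_0_absv le_max_iff_disj)
  have sub: "x \<in> cball 0 R" if "x \<in> cball c r" "r \<in> {\<rho>, \<sigma>, \<tau>}" for x r
  proof -
    have "absv x \<le> max (absv c) (absv (x - c))" by (rule absv_le_max_diff)
    also have "\<dots> \<le> R" using that
      by (auto simp: R_def dist_absv absv_minus_commute[of x c] le_max_iff_disj)
    finally show ?thesis by (simp add: dist_0_absv)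
  qed
  \<comment> \<open>An approximation within \<open>A\<close> and \<open>B\<close> keeps these bounds, because the absolute value is
    ultrametric; one that is closer than \<open>|f w|\<close> keeps the value \<open>|f w|\<close>.\<close>
  define e where "e = Min {A, B, absv (fps_val f w) / 2}"
  have e: "0 < e" "e \<le> A" "e \<le> B" "e < absv (fps_val f w)"
    using A(1) B(1) fw by (auto simp: e_def min_less_iff_disj)
  have "summable (\<lambda>n. fps_nth f n * x ^ n)" if "x \<in> unit_disk" for x
    using f that by (simp add: Hinf_def)
  from fps_val_poly_approx[OF this R e(1)]
  obtain p where p: "\<And>x. x \<in> cball 0 R \<Longrightarrow> absv (fps_val f x - poly p x) \<le> e" by blast
  have p_le: "absv (poly p x) \<le> max (absv (fps_val f x)) e" if "x \<in> cball 0 R" for x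
    using absv_le_max_diff[of "poly p x" "fps_val f x"] p[OF that]
    by (auto simp: absv_minus_commute[of "poly p x"])
  have "absv (fps_val f w) \<le> absv (poly p w)"
    using absv_le_max_diff[of "fps_val f w" "poly p w"] p[OF sub[OF w]] e(4) by auto
  then have "absv (fps_val f w) ^ Suc m \<le> absv (poly p w) ^ Suc m"
    using fw by (intro power_mono) auto
  also have "\<dots> \<le> A * B ^ m"
  proof (rule poly_three_circles[OF _ _ _ _ \<sigma>(2) _ _ w])
    show "absv (poly p x) \<le> A" if "x \<in> cball c \<rho>" for x
      using p_le[OF sub[OF that]] A(2)[OF that] e(2) by auto
    show "absv (poly p x) \<le> B" if "x \<in> cball c \<tau>" for x
      using p_le[OF sub[OF that]] B(2)[OF that] e(3) by auto
  qed (use \<rho> \<tau> in auto)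
  finally show ?thesis .
qed

lemma cball_subset_unit_disk:
  fixes c :: "'k::nonarch_field"
  assumes "c \<in> unit_disk" "r < 1"
  shows "cball c r \<subseteq> unit_disk"
proof
  fix x assume "x \<in> cball c r"
  then show "x \<in> unit_disk"
    using absv_le_max_diff[of x c] assms
    by (auto simp: dist_0_absv dist_absv absv_minus_commute[of c x] absv_minus le_max_iff_disj)
qed

lemma zeta_disk_three_circles:
  fixes f :: "'k::{nonarch_field, alg_closed_field} fps"
  assumes f: "f \<in> Hinf" and c: "c \<in> unit_disk"
    and B: "0 < B" "\<And>w. w \<in> unit_disk \<Longrightarrow> absv (fps_val f w) \<le> B"
    and \<rho>: "0 < \<rho>" "\<rho> < 1" and \<tau>: "0 < \<tau>" "\<tau> < 1"
    and \<sigma>: "0 < \<sigma>" "\<sigma> < 1" "\<sigma> ^ Suc m \<le> \<rho> * \<tau> ^ m"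
  shows "zeta_disk (cball c \<sigma>) f ^ Suc m \<le> zeta_disk (cball c \<rho>) f * B ^ m"
proof -
  let ?M = "\<lambda>r. zeta_disk (cball c r) f"
  have upper: "absv (fps_val f w) \<le> ?M r" if "w \<in> cball c r" "r < 1" for w r
    unfolding zeta_disk_def
    using that cball_subset_unit_disk[OF c that(2)] B(2)
    by (intro cSUP_upper bdd_aboveI[of _ B]) blast+
  have nonneg: "0 \<le> ?M r" if "0 < r" "r < 1" for r
    using upper[of c r] that absv_ge_0[of "fps_val f c"] by simp
  have "?M \<sigma> ^ Suc m \<le> A * B ^ m" if A: "?M \<rho> < A" for A
  proof -
    have A0: "0 < A" using nonneg[OF \<rho>] A by simp
    have "absv (fps_val f w) \<le> root (Suc m) (A * B ^ m)" if w: "w \<in> cball c \<sigma>" for w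
    proof -
      have "absv (fps_val f w) ^ Suc m \<le> A * B ^ m"
        by (rule Hinf_three_circles_pointwise[OF f c \<rho> \<tau> \<sigma>(2,3) A0 _ B(1) _ w])
          (use upper \<rho> A B(2) cball_subset_unit_disk[OF c \<tau>(2)] in \<open>force+\<close>)
      then show ?thesis using absv_ge_0 by (intro le_root_if_power_le)
    qed
    then have "?M \<sigma> \<le> root (Suc m) (A * B ^ m)"
      unfolding zeta_disk_def using \<sigma>(1) by (intro cSUP_least) auto
    then have "?M \<sigma> ^ Suc m \<le> root (Suc m) (A * B ^ m) ^ Suc m"
      using nonneg[OF \<sigma>(1,2)] by (intro power_mono)
    also have "\<dots> = A * B ^ m" using A0 B(1) by (intro real_root_pow_pos2) auto
    finally show ?thesis .
  qed
  then have "?M \<sigma> ^ Suc m / B ^ m \<le> A" if "?M \<rho> < A" for A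
    using that B(1) by (simp only: pos_divide_le_eq zero_less_power)
  then have "?M \<sigma> ^ Suc m / B ^ m \<le> ?M \<rho>" by (rule dense_ge)
  then show ?thesis using B(1) by (simp only: pos_divide_le_eq zero_less_power)
qed

section \<open>The kernels of the limit seminorms\<close>

text \<open>
  The radii in the limit are \<open>k\<^sub>n\<close>-th roots, and taking roots preserves the multiplicative
  relation between the radii; so one exponent \<open>m\<close> serves all \<open>n\<close>.
\<close>
lemma zeta_three_circles:
  fixes z :: "nat \<Rightarrow> 'k::{nonarch_field, alg_closed_field}"
  assumes u: "is_ultrafilter \<uu>" and z: "range z \<subseteq> unit_disk" and k: "\<And>n. k n \<ge> 1" and f: "f \<in> Hinf"
    and B: "0 < B" "\<And>w. w \<in> unit_disk \<Longrightarrow> absv (fps_val f w) \<le> B"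
    and r: "0 < r" "r < 1" and t: "0 < t" "t < 1" and s: "0 < s" "s < 1" "s ^ Suc m \<le> r * t ^ m"
  shows "zeta \<uu> z k s f ^ Suc m \<le> zeta \<uu> z k r f * B ^ m"
proof (rule tendsto_le)
  show "\<uu> \<noteq> bot" using u by (simp add: is_ultrafilter_def)
  note lim = zeta_limits(1)[where k = k, OF u z k f]
  show "((\<lambda>n. zeta_disk (cball (z n) (root (k n) s)) f ^ Suc m) \<longlongrightarrow> zeta \<uu> z k s f ^ Suc m) \<uu>"
    by (intro tendsto_power lim s)
  show "((\<lambda>n. zeta_disk (cball (z n) (root (k n) r)) f * B ^ m) \<longlongrightarrow> zeta \<uu> z k r f * B ^ m) \<uu>"
    by (intro tendsto_mult tendsto_const lim r)
  show "eventually (\<lambda>n. zeta_disk (cball (z n) (root (k n) s)) f ^ Suc m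
      \<le> zeta_disk (cball (z n) (root (k n) r)) f * B ^ m) \<uu>"
  proof (intro always_eventually allI)
    fix n
    have kn: "0 < k n" using k[of n] by simp
    have root: "0 < root (k n) x" "root (k n) x < 1" if "0 < x" "x < 1" for x
      using that kn by auto
    have "root (k n) (s ^ Suc m) \<le> root (k n) (r * t ^ m)" using s(3) kn by simp
    then have "root (k n) s ^ Suc m \<le> root (k n) r * root (k n) t ^ m"
      using kn by (simp only: real_root_mult real_root_power)
    then show "zeta_disk (cball (z n) (root (k n) s)) f ^ Suc m
        \<le> zeta_disk (cball (z n) (root (k n) r)) f * B ^ m"
      using root r s(1,2) t
      by (intro zeta_disk_three_circles[OF f subsetD[OF z rangeI] B]) simp_all
  qed
qed

text \<open>
  A zero at one parameter \<open>r < 1\<close> spreads to all other parameters by the three circles inequality,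
  whose right-hand side vanishes. The case \<open>m = 0\<close> of the inequality is monotonicity in the
  parameter, which gives the converse.
\<close>
lemma zeta_eq_0_iff:
  fixes z :: "nat \<Rightarrow> 'k::{nonarch_field, alg_closed_field}"
  assumes u: "is_ultrafilter \<uu>" and z: "range z \<subseteq> unit_disk" and k: "\<And>n. k n \<ge> 1" and f: "f \<in> Hinf"
    and r: "0 < r" "r < 1"
  shows "zeta \<uu> z k r f = 0 \<longleftrightarrow> zeta \<uu> z k 1 f = 0"
proof -
  obtain B0 where "\<And>w. w \<in> unit_disk \<Longrightarrow> absv (fps_val f w) \<le> B0"
    using f unfolding Hinf_def bounded_any_center[where a=0]
    by (auto simp: dist_0_absv simp del: mem_ball)
  then have B: "0 < max 1 B0" "\<And>w. w \<in> unit_disk \<Longrightarrow> absv (fps_val f w) \<le> max 1 B0"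
    by (auto simp: le_max_iff_disj simp del: mem_ball)
  have ineq: "zeta \<uu> z k s f ^ Suc m \<le> zeta \<uu> z k r f * max 1 B0 ^ m"
    if "0 < r" "r < 1" "0 < t" "t < 1" "0 < s" "s < 1" "s ^ Suc m \<le> r * t ^ m" for r s t m
    by (intro zeta_three_circles[where k = k and t = t] u z k f B that)
  have nonneg: "0 \<le> zeta \<uu> z k s f" if s: "0 < s" "s < 1" for s
  proof (rule tendsto_lowerbound[OF zeta_limits(1)[where k = k, OF u z k f s]])
    show "\<uu> \<noteq> bot" using u by (simp add: is_ultrafilter_def)
    show "eventually (\<lambda>n. 0 \<le> zeta_disk (cball (z n) (root (k n) s)) f) \<uu>"
    proof (intro always_eventually allI)
      fix n
      have kn: "0 < k n" using k[of n] by simp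
      have c: "z n \<in> unit_disk" using z by (rule subsetD) simp
      have sub: "cball (z n) (root (k n) s) \<subseteq> unit_disk"
        using s kn by (intro cball_subset_unit_disk[OF c]) simp
      have "absv (fps_val f (z n)) \<le> zeta_disk (cball (z n) (root (k n) s)) f"
        unfolding zeta_disk_def
      proof (rule cSUP_upper)
        show "z n \<in> cball (z n) (root (k n) s)" using s kn by simp
        show "bdd_above ((\<lambda>w. absv (fps_val f w)) ` cball (z n) (root (k n) s))"
          using B(2)[OF subsetD[OF sub]] by (intro bdd_aboveI[of _ "max 1 B0"]) auto
      qed
      then show "0 \<le> zeta_disk (cball (z n) (root (k n) s)) f"
        using absv_ge_0[of "fps_val f (z n)"] by linarith
    qed
  qed
  have mono: "zeta \<uu> z k s f \<le> zeta \<uu> z k s' f" if "0 < s" "s \<le> s'" "s' < 1" for s s'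
    using ineq[of s' "1/2" s 0] that by simp
  note lim = zeta_limits(2)[where k = k, OF u z k f]
  show ?thesis
  proof
    assume zr: "zeta \<uu> z k r f = 0"
    \<comment> \<open>With \<open>t\<close> strictly between \<open>s\<close> and \<open>1\<close>, the condition \<open>(s / t)^m < r\<close> makes the radii
      admissible.\<close>
    have zero: "zeta \<uu> z k s f = 0" if s: "0 < s" "s < 1" for s
    proof -
      define t where "t = (s + 1) / 2"
      have t: "0 < t" "t < 1" "s < t" using s by (auto simp: t_def)
      obtain m where "(s / t) ^ m < r" using real_arch_pow_inv[of r "s / t"] r s t by auto
      then have "s ^ m \<le> r * t ^ m" using t by (simp add: power_divide divide_simps)
      moreover have "s ^ Suc m \<le> s ^ m" using s by (simp add: mult_left_le_one_le)
      ultimately have "zeta \<uu> z k s f ^ Suc m \<le> 0"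
        using ineq[OF r t(1,2) s, of m] zr by simp
      then show ?thesis using nonneg[OF s] by (auto simp: power_le_zero_eq simp del: power_Suc)
    qed
    have "eventually (\<lambda>s. s \<in> {0<..<1}) (at_left (1::real))"
      by (intro eventually_at_left_real) simp
    then have "eventually (\<lambda>s. zeta \<uu> z k s f = 0) (at_left 1)"
      by eventually_elim (use zero in simp)
    then have "((\<lambda>s. zeta \<uu> z k s f) \<longlongrightarrow> 0) (at_left 1)" by (rule tendsto_eventually)
    then show "zeta \<uu> z k 1 f = 0" using lim by (intro tendsto_unique[OF trivial_limit_at_left_real])
  next
    assume z1: "zeta \<uu> z k 1 f = 0"
    have "eventually (\<lambda>s. s \<in> {r<..<1}) (at_left 1)" using r by (intro eventually_at_left_real)
    then have "eventually (\<lambda>s. zeta \<uu> z k r f \<le> zeta \<uu> z k s f) (at_left 1)"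
      by eventually_elim (use mono r in auto)
    then have "zeta \<uu> z k r f \<le> zeta \<uu> z k 1 f" by (intro tendsto_lowerbound[OF lim]) auto
    then show "zeta \<uu> z k r f = 0" using nonneg[OF r] z1 by simp
  qed
qed

theorem corollary2p5:
  fixes z :: "nat \<Rightarrow> 'k::{nonarch_field, complete_space, alg_closed_field}"
    and \<uu> :: "nat filter" and k :: "nat \<Rightarrow> nat"
  assumes "nonprincipal_ultrafilter \<uu>"
    and "range z \<subseteq> unit_disk"
    and "regular_seq \<uu> z"
    and "k \<in> Comp \<uu> z"
  shows "\<forall>r\<in>{0<..1}. \<forall>s\<in>{0<..1}. seminorm_ker (zeta \<uu> z k r) = seminorm_ker (zeta \<uu> z k s)"
proof -
  have u: "is_ultrafilter \<uu>" using assms(1) by (simp add: nonprincipal_ultrafilter_def)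
  have k: "k n \<ge> 1" for n using assms(4) by (simp add: Comp_def)
  have to_1: "seminorm_ker (zeta \<uu> z k r) = seminorm_ker (zeta \<uu> z k 1)" if "r \<in> {0<..1}" for r
  proof (cases "r = 1")
    case False
    have "zeta \<uu> z k r f = 0 \<longleftrightarrow> zeta \<uu> z k 1 f = 0" if "f \<in> Hinf" for f
      by (rule zeta_eq_0_iff[OF u assms(2) k that]) (use \<open>r \<in> _\<close> False in auto)
    then show ?thesis unfolding seminorm_ker_def by blast
  qed simp
  show ?thesis
  proof (intro ballI)
    fix r s :: real
    assume "r \<in> {0<..1}" "s \<in> {0<..1}"
    then show "seminorm_ker (zeta \<uu> z k r) = seminorm_ker (zeta \<uu> z k s)"
      using to_1[of r] to_1[of s] by (simp only:)
  qed
qed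

end
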